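(* Let $n,m,q,N$ be positive integers, $A\in\mathbb{R}^{n\times n}$, $B\in\mathbb{R}^{n\times m}$, and consider the controlled discrete-time linear system $x(k+1)=Ax(k)+Bu(k)+d(k)$ with state space $X\subset\mathbb{R}^n$ and input space $U\subset\mathbb{R}^m$ (no input constraints are imposed), controlled by the linear controller $u(k)=\pi_\alpha(x(k))=\alpha_1x(k)+\alpha_2$ with parameters $\alpha=(\alpha_1,\alpha_2)\in\mathbb{R}^{m\times n}\times\mathbb{R}^m$. Consider the specification $\psi=\Gamma_0\times\Gamma_1\times\cdots\times\Gamma_N\subseteq X^{N+1}$, where for $i=0,\dots,N$, $\Gamma_i=\{x\in X\mid G_ix\le H_i\}$ with $G_i\in\mathbb{R}^{q\times n}$ and $H_i\in\mathbb{R}^q$. Let $g_\psi$ be the resilience function (defined in the context), and let $x\in X$ be the initial state. Then $$g_\psi(x)=\max_{\varepsilon\ge 0,\ \alpha_1\in\mathbb{R}^{m\times n},\ \alpha_2\in\mathbb{R}^m,\ P\ge 0}\Big\{\varepsilon\ge 0 \ \Big|\ P\ge 0,\ PA_b=E(\alpha_1),\ \varepsilon PB_b\le F(x,\alpha_1,\alpha_2)\Big\},$$ where $P$ ranges over the entrywise non-negative matrices in $\mathbb{R}^{q(N+1)\times 2n(N+1)}$ and, with $\bar A=A+B\alpha_1$, $$A_b=\begin{bmatrix}\mathbb{I}_{n(N+1)}\\-\mathbb{I}_{n(N+1)}\end{bmatrix},\qquad B_b=\begin{bmatrix}\mathbf{1}_{n(N+1)}\\ \mathbf{1}_{n(N+1)}\end{bmatrix},$$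 $$E(\alpha_1)=\begin{bmatrix} \mathbf{0}_{q\times n}&\mathbf{0}&\mathbf{0}&\cdots&\mathbf{0}\\ \mathbf{0}&G_1&\mathbf{0}&\cdots&\mathbf{0}\\ \mathbf{0}&G_2\bar A&G_2&\cdots&\mathbf{0}\\ \vdots&\vdots&\ddots&\ddots&\vdots\\ \mathbf{0}&G_N\bar A^{N-1}&\cdots&G_N\bar A&G_N \end{bmatrix},$$ $$F(x,\alpha_1,\alpha_2)=\begin{bmatrix} H_0-G_0x\\ H_1-G_1\bar Ax-G_1B\alpha_2\\ \vdots\\ H_N-G_N\bar A^Nx-G_N\sum_{i=0}^{N-1}\bar A^iB\alpha_2 \end{bmatrix}.$$ That is, indexing the $q\times n$ blocks of $E(\alpha_1)$ by $(k,j)\in\{0,\dots,N\}^2$, block $(k,j)$ equals $G_k\bar A^{k-j}$ if $1\le j\le k$ and is zero otherwise.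
   Context: All inequalities between vectors or matrices are entrywise. $\mathbb{I}_r$ is the $r\times r$ identity matrix, $\mathbf{1}_r\in\mathbb{R}^r$ is the all-ones vector, and $\mathbf{0}$ denotes zero blocks. For $\varepsilon\ge0$, $\Omega_\varepsilon(0)=\{z\in\mathbb{R}^n\mid\|z\|_\infty\le\varepsilon\}$; the disturbance set of the system is $\Omega_\varepsilon(0)$. System: the nominal dynamics $(x,u)\mapsto Ax+Bu$ is regarded as a map $X\times U\to X$, the controller as a map $\pi_\alpha:X\to U$, and $d(k)\in\Omega_\varepsilon(0)$ is an additive disturbance. Trajectories: for $x\in X$, parameters $\alpha$ and $\varepsilon\ge0$, $\xi_x(x,\pi_\alpha,\varepsilon)\subseteq X^{N+1}$ is the set of all state sequences $(x(0),\dots,x(N))$ with $x(0)=x$ and $x(k+1)=Ax(k)+B\pi_\alpha(x(k))+d(k)$ for $k=0,\dots,N-1$, where $(d(0),\dots,d(N-1))$ ranges over all of $\Omega_\varepsilon(0)^N$. For $\varepsilon=0$ there is a single (nominal) trajectory, also denoted $\xi_x(x,\pi_\alpha,0)$. Resilience: $g_\psi:X\to\mathbb{R}_{\ge0}\cup\{+\infty\}$ is defined by $g_\psi(x)=\sup_{\varepsilon\ge0,\,\alpha}\{\varepsilon\ge0\mid \xi_x(x,\pi_\alpha,\varepsilon)\subseteq\psi\}$ if there exists $\alpha$ with $\xi_x(x,\pi_\alpha,0)\in\psi$, and $g_\psi(x)=0$ if $\xi_x(x,\pi_\alpha,0)\notin\psi$ for all $\alpha$. Convention: since the dynamics and the controller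 are continuous, for closed specifications the supremum in this definition is replaced by a maximum, and this replacement is used in the statement.
   Formalization: The maximum need not exist: it is read as a supremum (possibly infinite, 0 if infeasible), and a number is the maximum defining g_ψ(x) iff it is the right-hand maximum. X is assumed to contain all perturbed trajectories for every ε, as the context says, so X is all of R^n. *)

theory Defs
  imports
    Jordan_Normal_Form.Matrix
    "HOL-Library.Extended_Nonnegative_Real"
    "HOL-Library.FuncSet"
begin

text \<open>
  Vectors and matrices have explicit dimensions; the orders \<open>\<le>\<close> on \<^typ>\<open>real vec\<close> and
  \<^typ>\<open>real mat\<close> are the entrywise ones (they include equality of dimensions).
  An element \<open>(s 0, \<dots>, s N)\<close> of a product of \<open>N + 1\<close> sets is an extensional function on
  \<^term>\<open>{0..N}\<close>.
\<close>

definition linf_norm :: "real vec \<Rightarrow> real" where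
  "linf_norm z = Max ((\<lambda>i. \<bar>z $ i\<bar>) ` {0..<dim_vec z})"

definition disturbance_set :: "nat \<Rightarrow> real \<Rightarrow> real vec set" where
  "disturbance_set n \<epsilon> = {z \<in> carrier_vec n. linf_norm z \<le> \<epsilon>}"

definition controller :: "real mat \<Rightarrow> real vec \<Rightarrow> real vec \<Rightarrow> real vec" where
  "controller \<alpha>1 \<alpha>2 z = \<alpha>1 *\<^sub>v z + \<alpha>2"

definition trajectories ::
  "nat \<Rightarrow> real mat \<Rightarrow> real mat \<Rightarrow> nat \<Rightarrow> real vec \<Rightarrow> real mat \<Rightarrow> real vec \<Rightarrow> real \<Rightarrow> (nat \<Rightarrow> real vec) set"
where
  "trajectories n A B N x \<alpha>1 \<alpha>2 \<epsilon> =
     {s \<in> extensional {0..N}. s 0 = x \<and>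
        (\<exists>d \<in> {0..<N} \<rightarrow> disturbance_set n \<epsilon>.
           \<forall>k<N. s (Suc k) = A *\<^sub>v s k + B *\<^sub>v controller \<alpha>1 \<alpha>2 (s k) + d k)}"

definition robust_levels ::
  "nat \<Rightarrow> nat \<Rightarrow> real mat \<Rightarrow> real mat \<Rightarrow> nat \<Rightarrow> (nat \<Rightarrow> real vec) set \<Rightarrow> real vec \<Rightarrow> real set"
where
  "robust_levels n m A B N \<psi> x =
     {\<epsilon>. \<epsilon> \<ge> 0 \<and> (\<exists>\<alpha>1 \<in> carrier_mat m n. \<exists>\<alpha>2 \<in> carrier_vec m.
        trajectories n A B N x \<alpha>1 \<alpha>2 \<epsilon> \<subseteq> \<psi>)}"

text \<open>
  \<^term>\<open>trajectories n A B N x \<alpha>1 \<alpha>2 0\<close> is the singleton of the nominal trajectory, so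
  inclusion in \<open>\<psi>\<close> says that the nominal trajectory belongs to \<open>\<psi>\<close>.
\<close>

definition resilience ::
  "nat \<Rightarrow> nat \<Rightarrow> real mat \<Rightarrow> real mat \<Rightarrow> nat \<Rightarrow> (nat \<Rightarrow> real vec) set \<Rightarrow> real vec \<Rightarrow> ennreal"
where
  "resilience n m A B N \<psi> x =
     (if \<exists>\<alpha>1 \<in> carrier_mat m n. \<exists>\<alpha>2 \<in> carrier_vec m. trajectories n A B N x \<alpha>1 \<alpha>2 0 \<subseteq> \<psi>
      then Sup (ennreal ` robust_levels n m A B N \<psi> x)
      else 0)"

definition polyhedron_in :: "real vec set \<Rightarrow> real mat \<Rightarrow> real vec \<Rightarrow> real vec set" where
  "polyhedron_in X G H = {x \<in> X. G *\<^sub>v x \<le> H}"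

definition product_spec ::
  "real vec set \<Rightarrow> nat \<Rightarrow> (nat \<Rightarrow> real mat) \<Rightarrow> (nat \<Rightarrow> real vec) \<Rightarrow> (nat \<Rightarrow> real vec) set"
where
  "product_spec X N G H = (\<Pi>\<^sub>E i\<in>{0..N}. polyhedron_in X (G i) (H i))"

definition A_b :: "nat \<Rightarrow> nat \<Rightarrow> real mat" where
  "A_b n N = 1\<^sub>m (n * (N + 1)) @\<^sub>r (- 1\<^sub>m (n * (N + 1)))"

definition ones_vec :: "nat \<Rightarrow> real vec" where
  "ones_vec r = vec r (\<lambda>_. 1)"

definition B_b :: "nat \<Rightarrow> nat \<Rightarrow> real vec" where
  "B_b n N = ones_vec (n * (N + 1)) @\<^sub>v ones_vec (n * (N + 1))"

definition closed_loop :: "real mat \<Rightarrow> real mat \<Rightarrow> real mat \<Rightarrow> real mat" where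
  "closed_loop A B \<alpha>1 = A + B * \<alpha>1"

text \<open>
  Row \<open>r\<close> lies in block row \<open>r div q\<close> at position \<open>r mod q\<close>; column \<open>c\<close> lies in block column
  \<open>c div n\<close> at position \<open>c mod n\<close>; blocks are numbered from \<open>0\<close> to \<open>N\<close>.
\<close>

definition E_block ::
  "nat \<Rightarrow> nat \<Rightarrow> real mat \<Rightarrow> real mat \<Rightarrow> (nat \<Rightarrow> real mat) \<Rightarrow> real mat \<Rightarrow> nat \<Rightarrow> nat \<Rightarrow> real mat"
where
  "E_block n q A B G \<alpha>1 k j =
     (if 1 \<le> j \<and> j \<le> k then G k * closed_loop A B \<alpha>1 ^\<^sub>m (k - j) else 0\<^sub>m q n)"

definition E_mat ::
  "nat \<Rightarrow> nat \<Rightarrow> real mat \<Rightarrow> real mat \<Rightarrow> nat \<Rightarrow> (nat \<Rightarrow> real mat) \<Rightarrow> real mat \<Rightarrow> real mat"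
where
  "E_mat n q A B N G \<alpha>1 =
     mat (q * (N + 1)) (n * (N + 1))
       (\<lambda>(r, c). E_block n q A B G \<alpha>1 (r div q) (c div n) $$ (r mod q, c mod n))"

definition F_block ::
  "nat \<Rightarrow> real mat \<Rightarrow> real mat \<Rightarrow> (nat \<Rightarrow> real mat) \<Rightarrow> (nat \<Rightarrow> real vec) \<Rightarrow>
    real vec \<Rightarrow> real mat \<Rightarrow> real vec \<Rightarrow> nat \<Rightarrow> real vec"
where
  "F_block n A B G H x \<alpha>1 \<alpha>2 k =
     H k - G k *\<^sub>v ((closed_loop A B \<alpha>1 ^\<^sub>m k) *\<^sub>v x)
         - G k *\<^sub>v finsum_vec TYPE(real) n
             (\<lambda>i. (closed_loop A B \<alpha>1 ^\<^sub>m i) *\<^sub>v (B *\<^sub>v \<alpha>2)) {0..<k}"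

definition F_vec ::
  "nat \<Rightarrow> nat \<Rightarrow> real mat \<Rightarrow> real mat \<Rightarrow> nat \<Rightarrow> (nat \<Rightarrow> real mat) \<Rightarrow> (nat \<Rightarrow> real vec) \<Rightarrow>
    real vec \<Rightarrow> real mat \<Rightarrow> real vec \<Rightarrow> real vec"
where
  "F_vec n q A B N G H x \<alpha>1 \<alpha>2 =
     vec (q * (N + 1)) (\<lambda>r. F_block n A B G H x \<alpha>1 \<alpha>2 (r div q) $ (r mod q))"

definition feasible_levels ::
  "nat \<Rightarrow> nat \<Rightarrow> nat \<Rightarrow> real mat \<Rightarrow> real mat \<Rightarrow> nat \<Rightarrow> (nat \<Rightarrow> real mat) \<Rightarrow> (nat \<Rightarrow> real vec) \<Rightarrow>
    real vec \<Rightarrow> real set"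
where
  "feasible_levels n m q A B N G H x =
     {\<epsilon>. \<epsilon> \<ge> 0 \<and>
        (\<exists>\<alpha>1 \<in> carrier_mat m n. \<exists>\<alpha>2 \<in> carrier_vec m.
         \<exists>P \<in> carrier_mat (q * (N + 1)) (2 * n * (N + 1)).
           P \<ge> 0\<^sub>m (q * (N + 1)) (2 * n * (N + 1)) \<and>
           P * A_b n N = E_mat n q A B N G \<alpha>1 \<and>
           \<epsilon> \<cdot>\<^sub>v (P *\<^sub>v B_b n N) \<le> F_vec n q A B N G H x \<alpha>1 \<alpha>2)}"

text \<open>
  Since \<open>\<alpha>1\<close> and \<open>\<alpha>2\<close> are unrestricted, \<^const>\<open>robust_levels\<close> may be unbounded or
  have an unattained supremum even for closed specifications. The equality of the two maxima is
  therefore expressed by two facts: the suprema agree in \<^typ>\<open>ennreal\<close> (where \<open>Sup {} = 0\<close>),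
  and a number is the maximum of one set if and only if it is the maximum of the other.
\<close>

definition is_maximum :: "real set \<Rightarrow> real \<Rightarrow> bool" where
  "is_maximum S v \<longleftrightarrow> v \<in> S \<and> (\<forall>w\<in>S. w \<le> v)"

end

theory Submission
  imports Defs
begin

text \<open>
  Unrolling the dynamics, the \<open>k\<close>-th constraint along a trajectory is the \<open>k\<close>-th block row of
  \<open>E d \<le> F\<close>, where \<open>d\<close> stacks the disturbances. Over the box \<open>\<parallel>d\<parallel>\<^sub>\<infinity> \<le> \<epsilon>\<close> the
  left-hand side of a row has maximum \<open>\<epsilon>\<close> times the \<open>\<ell>\<^sub>1\<close>-norm of that row, attained at a sign
  vector. A nonnegative \<open>P = [P\<^sub>1 P\<^sub>2]\<close> with \<open>P A\<^sub>b = E\<close> writes \<open>E = P\<^sub>1 - P\<^sub>2\<close>, so the row sums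
  of \<open>P\<close> dominate these norms, with equality for the positive and negative parts of \<open>E\<close>. Hence
  the two sets of levels coincide, parameter by parameter.
\<close>

section \<open>Norms, matrix powers and flat block indices\<close>

text \<open>Positive dimension keeps the set under \<open>Max\<close> nonempty; the maximum of the
  empty set is unspecified.\<close>

lemma linf_norm_le_iff:
  assumes "dim_vec z > 0"
  shows "linf_norm z \<le> \<epsilon> \<longleftrightarrow> (\<forall>i<dim_vec z. \<bar>z $ i\<bar> \<le> \<epsilon>)"
  using assms by (subst linf_norm_def, subst Max_le_iff) auto

text \<open>Powers are defined by multiplication on the right, whereas the unrolling induction has
  to absorb a factor on the left.\<close>

lemma pow_mat_Suc_left:
  assumes "M \<in> carrier_mat n n"
  shows "M * M ^\<^sub>m k = M ^\<^sub>m Suc k"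
proof (induction k)
  case 0
  then show ?case using assms by simp
next
  case (Suc k)
  have "M * M ^\<^sub>m Suc k = (M * M ^\<^sub>m k) * M"
    using assms by (simp add: assoc_mult_mat[of _ n n _ n _ n])
  with Suc show ?case by simp
qed

text \<open>Pairing \<open>c\<close> with \<open>c + L\<close> matches the two stacked halves of
  \<open>A_b\<close> and \<open>B_b\<close>.\<close>

lemma sum_lessThan_double:
  fixes f :: "nat \<Rightarrow> 'a::comm_monoid_add"
  shows "sum f {0..<L + L} = (\<Sum>c<L. f c + f (c + L))"
proof -
  have "sum f {0..<L + L} = sum f {0..<L} + sum f {L..<L + L}"
    by (simp add: sum.atLeastLessThan_concat)
  also have "sum f {L..<L + L} = (\<Sum>c<L. f (c + L))"
    using sum.shift_bounds_nat_ivl[of f 0 L L] by (simp add: atLeast0LessThan)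
  finally show ?thesis by (simp add: sum.distrib atLeast0LessThan)
qed

text \<open>Flat indices are cut into consecutive intervals of length \<open>n\<close>, on each of
  which \<open>c div n\<close> is constant. This is how the columns of \<open>E_mat\<close> are
  regrouped into blocks.\<close>

lemma sum_div_mod:
  fixes f :: "nat \<Rightarrow> nat \<Rightarrow> 'a::comm_monoid_add"
  assumes "0 < n"
  shows "(\<Sum>c<n * K. f (c div n) (c mod n)) = (\<Sum>j<K. \<Sum>l<n. f j l)"
proof -
  have "(\<Sum>c<n * K. f (c div n) (c mod n))
      = (\<Sum>j<K. \<Sum>c=j * n..<j * n + n. f (c div n) (c mod n))"
    using sum.nat_group[of "\<lambda>c. f (c div n) (c mod n)" n K] by (simp add: mult.commute)
  also have "\<dots> = (\<Sum>j<K. \<Sum>l<n. f j l)"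
  proof (rule sum.cong[OF refl])
    fix j
    have "(\<Sum>c=j * n..<j * n + n. f (c div n) (c mod n))
        = (\<Sum>l=0..<n. f ((l + j * n) div n) ((l + j * n) mod n))"
      using sum.shift_bounds_nat_ivl[of "\<lambda>c. f (c div n) (c mod n)" 0 "j * n" n]
      by (simp add: add.commute)
    also have "\<dots> = (\<Sum>l<n. f j l)"
      using assms by (intro sum.cong) auto
    finally show "(\<Sum>c=j * n..<j * n + n. f (c div n) (c mod n)) = (\<Sum>l<n. f j l)" .
  qed
  finally show ?thesis .
qed

lemma block_index_less:
  fixes i k q N :: nat
  assumes "i < q" "k \<le> N"
  shows "k * q + i < q * (N + 1)"
proof -
  have "k * q + i < (k + 1) * q" using assms by simp
  also have "\<dots> \<le> (N + 1) * q" using assms by (intro mult_le_mono1) simp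
  finally show ?thesis by (simp add: mult.commute)
qed

lemma mult_mat_vec_index_sum:
  assumes "M \<in> carrier_mat r c" "v \<in> carrier_vec c" "i < r"
  shows "(M *\<^sub>v v) $ i = (\<Sum>l<c. M $$ (i, l) * v $ l)"
  using assms by (auto simp: scalar_prod_def atLeast0LessThan intro!: sum.cong)

text \<open>Exchanging two finite sums gives linearity over \<open>finsum_vec\<close>, whose sums
  are taken in a carrier of fixed dimension.\<close>

lemma mult_mat_finsum_vec_index:
  assumes "g \<in> carrier_mat q n" "i < q" "finite S" "v \<in> S \<rightarrow> carrier_vec n"
  shows "(g *\<^sub>v finsum_vec TYPE('a::comm_semiring_0) n v S) $ i = (\<Sum>j\<in>S. (g *\<^sub>v v j) $ i)"
proof -
  have vj: "v j \<in> carrier_vec n" if "j \<in> S" for j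
    using assms(4) that by auto
  have "(g *\<^sub>v finsum_vec TYPE('a) n v S) $ i
      = (\<Sum>l<n. g $$ (i, l) * (\<Sum>j\<in>S. v j $ l))"
    using assms
    by (subst mult_mat_vec_index_sum[OF assms(1) finsum_vec_closed assms(2)])
      (auto simp: index_finsum_vec)
  also have "\<dots> = (\<Sum>j\<in>S. \<Sum>l<n. g $$ (i, l) * v j $ l)"
    by (simp add: sum_distrib_left) (rule sum.swap)
  also have "\<dots> = (\<Sum>j\<in>S. (g *\<^sub>v v j) $ i)"
    using mult_mat_vec_index_sum[OF assms(1) vj assms(2)] by simp
  finally show ?thesis .
qed

section \<open>Unrolling the affine dynamics\<close>

text \<open>Discrete variation of constants, observed through row \<open>i\<close> of
  \<open>g\<close>. The induction peels off the last step and keeps \<open>g\<close> arbitrary, so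
  that the matrix of that step moves into the observation and the hypothesis applies to
  \<open>g * M\<close>.\<close>

lemma affine_trajectory_unroll:
  fixes M g :: "real mat" and s d :: "nat \<Rightarrow> real vec"
  assumes M: "M \<in> carrier_mat n n" and b: "b \<in> carrier_vec n" and x: "x \<in> carrier_vec n"
    and "g \<in> carrier_mat q n" and i: "i < q"
    and s0: "s 0 = x"
    and "\<And>j. j < k \<Longrightarrow> d j \<in> carrier_vec n"
    and "\<And>j. j < k \<Longrightarrow> s (Suc j) = M *\<^sub>v s j + b + d j"
  shows "s k \<in> carrier_vec n \<and>
    (g *\<^sub>v s k) $ i = (g *\<^sub>v (M ^\<^sub>m k *\<^sub>v x)) $ i
      + (g *\<^sub>v finsum_vec TYPE(real) n (\<lambda>j. M ^\<^sub>m j *\<^sub>v b) {0..<k}) $ i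
      + (\<Sum>j<k. ((g * M ^\<^sub>m (k - Suc j)) *\<^sub>v d j) $ i)"
  using assms(4,7,8)
proof (induction k arbitrary: g)
  case 0
  have "g *\<^sub>v 0\<^sub>v n = 0\<^sub>v q" using 0 by auto
  with 0 s0 M x i show ?case by (simp add: finsum_vec_empty)
next
  case (Suc k)
  note g = Suc.prems(1)
  have gM: "g * M \<in> carrier_mat q n" using g M by simp
  have IH: "s k \<in> carrier_vec n"
    "((g * M) *\<^sub>v s k) $ i = ((g * M) *\<^sub>v (M ^\<^sub>m k *\<^sub>v x)) $ i
      + ((g * M) *\<^sub>v finsum_vec TYPE(real) n (\<lambda>j. M ^\<^sub>m j *\<^sub>v b) {0..<k}) $ i
      + (\<Sum>j<k. ((g * M * M ^\<^sub>m (k - Suc j)) *\<^sub>v d j) $ i)"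
    using Suc.IH[OF gM] Suc.prems(2,3) by auto
  have dk: "d k \<in> carrier_vec n" and sk: "s (Suc k) = M *\<^sub>v s k + b + d k"
    using Suc.prems(2,3) by auto
  have shift: "g * M * M ^\<^sub>m j = g * M ^\<^sub>m Suc j" for j
    using M g by (subst pow_mat_Suc_left[OF M, symmetric]) (simp add: assoc_mult_mat[of _ q n _ n _ n])
  have pw: "M ^\<^sub>m j *\<^sub>v v \<in> carrier_vec n" if "v \<in> carrier_vec n" for j and v :: "real vec"
    using mult_mat_vec_carrier[OF pow_carrier_mat[OF M] that] .
  have assoc: "(g * M) *\<^sub>v (M ^\<^sub>m j *\<^sub>v v) = g *\<^sub>v (M ^\<^sub>m Suc j *\<^sub>v v)"
    if "v \<in> carrier_vec n" for j and v :: "real vec"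
  proof -
    have "(g * M) *\<^sub>v (M ^\<^sub>m j *\<^sub>v v) = (g * M * M ^\<^sub>m j) *\<^sub>v v"
      using assoc_mult_mat_vec[OF gM pow_carrier_mat[OF M] that] by (rule sym)
    also have "\<dots> = g *\<^sub>v (M ^\<^sub>m Suc j *\<^sub>v v)"
      unfolding shift using assoc_mult_mat_vec[OF g pow_carrier_mat[OF M] that] .
    finally show ?thesis .
  qed
  have "(g *\<^sub>v s (Suc k)) $ i = ((g * M) *\<^sub>v s k) $ i + (g *\<^sub>v b) $ i + (g *\<^sub>v d k) $ i"
  proof -
    have Ms: "M *\<^sub>v s k \<in> carrier_vec n" using mult_mat_vec_carrier[OF M IH(1)] .
    have "g *\<^sub>v s (Suc k) = g *\<^sub>v (M *\<^sub>v s k) + g *\<^sub>v b + g *\<^sub>v d k"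
      unfolding sk using Ms b dk
      by (simp only: mult_add_distrib_mat_vec[OF g] add_carrier_vec)
    moreover have "(g * M) *\<^sub>v s k = g *\<^sub>v (M *\<^sub>v s k)"
      using assoc_mult_mat_vec[OF g M IH(1)] .
    ultimately show ?thesis using g i by simp
  qed
  \<comment> \<open>Multiplication by \<open>M\<close> shifts the exponents up by one; the fresh
    constant term \<open>b\<close> supplies exponent 0.\<close>
  moreover have "((g * M) *\<^sub>v finsum_vec TYPE(real) n (\<lambda>j. M ^\<^sub>m j *\<^sub>v b) {0..<k}) $ i + (g *\<^sub>v b) $ i
      = (g *\<^sub>v finsum_vec TYPE(real) n (\<lambda>j. M ^\<^sub>m j *\<^sub>v b) {0..<Suc k}) $ i"
  proof -
    have "((g * M) *\<^sub>v finsum_vec TYPE(real) n (\<lambda>j. M ^\<^sub>m j *\<^sub>v b) {0..<k}) $ i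
        = (\<Sum>j=0..<k. (g *\<^sub>v (M ^\<^sub>m Suc j *\<^sub>v b)) $ i)"
      using pw[OF b]
      by (subst mult_mat_finsum_vec_index[OF gM i]) (auto simp only: assoc[OF b] finite_atLeastLessThan Pi_iff)
    moreover have "(g *\<^sub>v finsum_vec TYPE(real) n (\<lambda>j. M ^\<^sub>m j *\<^sub>v b) {0..<Suc k}) $ i
        = (\<Sum>j=0..<Suc k. (g *\<^sub>v (M ^\<^sub>m j *\<^sub>v b)) $ i)"
      using pw[OF b] by (subst mult_mat_finsum_vec_index[OF g i]) auto
    moreover have "M ^\<^sub>m 0 *\<^sub>v b = b" using M b by simp
    ultimately show ?thesis by (simp only: sum.atLeast0_lessThan_Suc_shift) simp
  qed
  \<comment> \<open>Older disturbances gain a factor \<open>M\<close>, as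
    \<open>Suc (k - Suc j) = k - j\<close> for \<open>j < k\<close>, while the newest one
    \<open>d k\<close> enters with exponent 0.\<close>
  moreover have "(\<Sum>j<k. ((g * M * M ^\<^sub>m (k - Suc j)) *\<^sub>v d j) $ i) + (g *\<^sub>v d k) $ i
      = (\<Sum>j<Suc k. ((g * M ^\<^sub>m (Suc k - Suc j)) *\<^sub>v d j) $ i)"
  proof -
    have "(\<Sum>j<k. ((g * M * M ^\<^sub>m (k - Suc j)) *\<^sub>v d j) $ i)
        = (\<Sum>j<k. ((g * M ^\<^sub>m (Suc k - Suc j)) *\<^sub>v d j) $ i)"
      by (intro sum.cong refl) (simp only: shift Suc_diff_Suc diff_Suc_Suc lessThan_iff)
    moreover have "g * M ^\<^sub>m 0 = g" using g M by simp
    ultimately show ?thesis by simp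
  qed
  moreover have "s (Suc k) \<in> carrier_vec n"
    unfolding sk using dk
    by (rule add_carrier_vec[OF add_carrier_vec[OF mult_mat_vec_carrier[OF M IH(1)] b]])
  ultimately show ?case using IH(2) assoc[OF x, of k] by simp
qed

text \<open>
  Block column \<open>j \<ge> 1\<close> acts on \<open>d (j - 1)\<close>. For \<open>j = 0\<close> the truncated subtraction gives \<open>d 0\<close>,
  which is harmless because that block column is zero.
\<close>

lemma E_mat_row_mult:
  fixes d :: "nat \<Rightarrow> real vec"
  assumes n: "0 < n" and "A \<in> carrier_mat n n" "B \<in> carrier_mat n m" "\<alpha>1 \<in> carrier_mat m n"
    and Gk: "G k \<in> carrier_mat q n" and k: "k \<le> N" and i: "i < q"
    and d: "\<And>j. j < k \<Longrightarrow> d j \<in> carrier_vec n"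
  shows "(\<Sum>c<n * (N + 1). E_mat n q A B N G \<alpha>1 $$ (k * q + i, c) * d (c div n - 1) $ (c mod n))
    = (\<Sum>j<k. ((G k * closed_loop A B \<alpha>1 ^\<^sub>m (k - Suc j)) *\<^sub>v d j) $ i)"
proof -
  let ?M = "closed_loop A B \<alpha>1"
  have M: "?M \<in> carrier_mat n n" using assms by (simp add: closed_loop_def)
  define f where "f j l = E_block n q A B G \<alpha>1 k j $$ (i, l) * d (j - 1) $ l" for j l
  have "(\<Sum>c<n * (N + 1). E_mat n q A B N G \<alpha>1 $$ (k * q + i, c) * d (c div n - 1) $ (c mod n))
      = (\<Sum>c<n * (N + 1). f (c div n) (c mod n))"
    using block_index_less[OF i k] i by (intro sum.cong) (auto simp: E_mat_def f_def)
  also have "\<dots> = (\<Sum>j<Suc N. \<Sum>l<n. f j l)"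
    using sum_div_mod[OF n, of f "N + 1"] by simp
  also have "\<dots> = (\<Sum>l<n. f 0 l) + (\<Sum>j<N. \<Sum>l<n. f (Suc j) l)"
    by (rule sum.lessThan_Suc_shift)
  also have "(\<Sum>l<n. f 0 l) = 0"
    using i by (simp add: f_def E_block_def)
  \<comment> \<open>Causality: only disturbances before time \<open>k\<close> influence the state at
    time \<open>k\<close>, so the later block columns vanish.\<close>
  also have "(\<Sum>j<N. \<Sum>l<n. f (Suc j) l) = (\<Sum>j<k. \<Sum>l<n. f (Suc j) l)"
    using k i by (intro sum.mono_neutral_right) (auto simp: f_def E_block_def)
  also have "\<dots> = (\<Sum>j<k. ((G k * ?M ^\<^sub>m (k - Suc j)) *\<^sub>v d j) $ i)"
  proof (rule sum.cong[OF refl])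
    fix j assume "j \<in> {..<k}"
    then have "j < k" by simp
    have "G k * ?M ^\<^sub>m (k - Suc j) \<in> carrier_mat q n"
      using mult_carrier_mat[OF Gk pow_carrier_mat[OF M]] .
    from mult_mat_vec_index_sum[OF this d[OF \<open>j < k\<close>] i]
    show "(\<Sum>l<n. f (Suc j) l) = ((G k * ?M ^\<^sub>m (k - Suc j)) *\<^sub>v d j) $ i"
      using \<open>j < k\<close> by (simp add: f_def E_block_def)
  qed
  finally show ?thesis by simp
qed

text \<open>Closing the loop makes the dynamics affine with matrix
  \<open>closed_loop A B \<alpha>1\<close> and constant \<open>B *\<^sub>v \<alpha>2\<close>. In the
  unrolled constraint, everything free of disturbances moves to the right-hand side and forms the
  entry of \<open>F_vec\<close>.\<close>

lemma trajectory_constraint_iff: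
  assumes n: "0 < n" and A: "A \<in> carrier_mat n n" and B: "B \<in> carrier_mat n m"
    and \<alpha>1: "\<alpha>1 \<in> carrier_mat m n" and \<alpha>2: "\<alpha>2 \<in> carrier_vec m" and x: "x \<in> carrier_vec n"
    and Gk: "G k \<in> carrier_mat q n" and Hk: "H k \<in> carrier_vec q" and k: "k \<le> N" and i: "i < q"
    and s0: "s 0 = x" and d: "\<And>j. j < N \<Longrightarrow> d j \<in> carrier_vec n"
    and step: "\<And>j. j < N \<Longrightarrow> s (Suc j) = A *\<^sub>v s j + B *\<^sub>v controller \<alpha>1 \<alpha>2 (s j) + d j"
  shows "(G k *\<^sub>v s k) $ i \<le> H k $ i \<longleftrightarrow>
    (\<Sum>c<n * (N + 1). E_mat n q A B N G \<alpha>1 $$ (k * q + i, c) * d (c div n - 1) $ (c mod n))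
      \<le> F_vec n q A B N G H x \<alpha>1 \<alpha>2 $ (k * q + i)"
proof -
  let ?M = "closed_loop A B \<alpha>1"
  let ?S = "finsum_vec TYPE(real) n (\<lambda>j. ?M ^\<^sub>m j *\<^sub>v (B *\<^sub>v \<alpha>2)) {0..<k}"
  have M: "?M \<in> carrier_mat n n" using A B \<alpha>1 by (simp add: closed_loop_def)
  have b: "B *\<^sub>v \<alpha>2 \<in> carrier_vec n" using B \<alpha>2 by simp
  have loop: "A *\<^sub>v z + B *\<^sub>v controller \<alpha>1 \<alpha>2 z = ?M *\<^sub>v z + B *\<^sub>v \<alpha>2" if z: "z \<in> carrier_vec n" for z
  proof -
    have 1: "\<alpha>1 *\<^sub>v z \<in> carrier_vec m" and BA: "B * \<alpha>1 \<in> carrier_mat n n"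
      using B \<alpha>1 z by auto
    have "A *\<^sub>v z + B *\<^sub>v controller \<alpha>1 \<alpha>2 z = A *\<^sub>v z + ((B * \<alpha>1) *\<^sub>v z + B *\<^sub>v \<alpha>2)"
      unfolding controller_def mult_add_distrib_mat_vec[OF B 1 \<alpha>2]
      using assoc_mult_mat_vec[OF B \<alpha>1 z] by simp
    also have "\<dots> = ?M *\<^sub>v z + B *\<^sub>v \<alpha>2"
      unfolding closed_loop_def add_mult_distrib_mat_vec[OF A BA z]
      using A BA z b by (intro assoc_add_vec[symmetric, of _ n]) auto
    finally show ?thesis .
  qed
  \<comment> \<open>A vector sum takes its dimension from the last summand, so \<open>d j'\<close>
    alone determines that of the successor state and a case split suffices.\<close>
  have sc: "s j \<in> carrier_vec n" if "j \<le> N" for j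
  proof (cases j)
    case (Suc j')
    then have "d j' \<in> carrier_vec n" using that d by simp
    then show ?thesis
      using Suc that step[of j']
      by (simp only: Suc_le_eq index_add_vec carrier_vec_def mem_Collect_eq)
  qed (simp add: s0 x)
  have "(G k *\<^sub>v s k) $ i = (G k *\<^sub>v (?M ^\<^sub>m k *\<^sub>v x)) $ i + (G k *\<^sub>v ?S) $ i
      + (\<Sum>j<k. ((G k * ?M ^\<^sub>m (k - Suc j)) *\<^sub>v d j) $ i)"
    using k step d loop[OF sc]
    by (intro affine_trajectory_unroll[where d = d and s = s and k = k, OF M b x Gk i s0, THEN conjunct2]) auto
  moreover have "F_vec n q A B N G H x \<alpha>1 \<alpha>2 $ (k * q + i)
      = H k $ i - (G k *\<^sub>v (?M ^\<^sub>m k *\<^sub>v x)) $ i - (G k *\<^sub>v ?S) $ i"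
    using block_index_less[OF i k] i Gk Hk by (simp add: F_vec_def F_block_def)
  moreover note E_mat_row_mult[where d = d and G = G and k = k, OF n A B \<alpha>1 Gk k i]
  ultimately show ?thesis using d k by auto
qed

section \<open>Worst-case disturbances in the box\<close>

lemma mult_le_abs_bound:
  fixes a v :: real
  assumes "\<bar>v\<bar> \<le> \<epsilon>"
  shows "a * v \<le> \<epsilon> * \<bar>a\<bar>"
proof -
  have "a * v \<le> \<bar>a\<bar> * \<bar>v\<bar>" by (simp flip: abs_mult)
  also have "\<dots> \<le> \<bar>a\<bar> * \<epsilon>" using assms by (intro mult_left_mono) auto
  finally show ?thesis by (simp add: mult.commute)
qed

text \<open>The l1-norm is dual to the infinity norm. Each row may have its own worst disturbance,
  because inclusion quantifies over all trajectories and so separates into rows. The assumption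
  \<open>X\<close> supplies membership in the state space, leaving only linear inequalities.\<close>

lemma trajectories_subset_iff:
  assumes n: "0 < n" and q: "0 < q" and A: "A \<in> carrier_mat n n" and B: "B \<in> carrier_mat n m"
    and G: "\<And>i. i \<le> N \<Longrightarrow> G i \<in> carrier_mat q n"
    and H: "\<And>i. i \<le> N \<Longrightarrow> H i \<in> carrier_vec q"
    and x: "x \<in> carrier_vec n" and \<epsilon>: "0 \<le> \<epsilon>"
    and \<alpha>1: "\<alpha>1 \<in> carrier_mat m n" and \<alpha>2: "\<alpha>2 \<in> carrier_vec m"
    and X: "trajectories n A B N x \<alpha>1 \<alpha>2 \<epsilon> \<subseteq> {0..N} \<rightarrow>\<^sub>E X"
  shows "trajectories n A B N x \<alpha>1 \<alpha>2 \<epsilon> \<subseteq> product_spec X N G H \<longleftrightarrow>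
    (\<forall>r<q * (N + 1). \<epsilon> * (\<Sum>c<n * (N + 1). \<bar>E_mat n q A B N G \<alpha>1 $$ (r, c)\<bar>)
        \<le> F_vec n q A B N G H x \<alpha>1 \<alpha>2 $ r)"
    (is "?T \<subseteq> ?\<psi> \<longleftrightarrow> (\<forall>r<_. \<epsilon> * (\<Sum>c<_. \<bar>?E $$ (r, c)\<bar>) \<le> ?F $ r)")
proof
  assume sub: "?T \<subseteq> ?\<psi>"
  show "\<forall>r<q * (N + 1). \<epsilon> * (\<Sum>c<n * (N + 1). \<bar>?E $$ (r, c)\<bar>) \<le> ?F $ r"
  proof (intro allI impI)
    fix r assume r: "r < q * (N + 1)"
    define k where "k = r div q"
    define i where "i = r mod q"
    have i: "i < q" and rk: "r = k * q + i" using q by (simp_all add: i_def k_def)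
    have k: "k \<le> N"
      using r unfolding k_def
      by (metis less_mult_imp_div_less mult.commute Suc_eq_plus1 less_Suc_eq_le)
    \<comment> \<open>The maximiser for row \<open>r\<close>: signs of its entries scaled by
      \<open>\<epsilon>\<close>. The shift to \<open>Suc j\<close> appears because
      \<open>d j\<close> is multiplied by block column \<open>j + 1\<close>.\<close>
    define d where "d j = vec n (\<lambda>l. \<epsilon> * sgn (?E $$ (r, Suc j * n + l)))" for j
    \<comment> \<open>The recursion runs for all times; restricting it to \<open>{0..N}\<close>
      gives the extensional sequence that \<open>trajectories\<close> requires.\<close>
    define s' where
      "s' = rec_nat x (\<lambda>j z. A *\<^sub>v z + B *\<^sub>v controller \<alpha>1 \<alpha>2 z + d j)"
    define s where "s = restrict s' {0..N}"
    have s0: "s 0 = x" by (simp add: s_def s'_def)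
    have step: "s (Suc j) = A *\<^sub>v s j + B *\<^sub>v controller \<alpha>1 \<alpha>2 (s j) + d j" if "j < N" for j
      using that by (simp add: s_def s'_def)
    have dc: "d j \<in> carrier_vec n" for j by (simp add: d_def)
    have "d j \<in> disturbance_set n \<epsilon>" for j
      using n \<epsilon> by (auto simp: disturbance_set_def linf_norm_le_iff d_def abs_mult sgn_real_def)
    then have "s \<in> ?T"
      unfolding trajectories_def using s0 step by (auto simp: s_def intro!: bexI[of _ d])
    with sub have "s k \<in> polyhedron_in X (G k) (H k)"
      using k unfolding product_spec_def by (auto dest!: subsetD PiE_mem)
    then have "(G k *\<^sub>v s k) $ i \<le> H k $ i"
      using i H[OF k] by (auto simp: polyhedron_in_def less_eq_vec_def)
    then have le: "(\<Sum>c<n * (N + 1). ?E $$ (r, c) * d (c div n - 1) $ (c mod n)) \<le> ?F $ r"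
      using trajectory_constraint_iff[of n A B m \<alpha>1 \<alpha>2 x G k q H N i s d,
          OF n A B \<alpha>1 \<alpha>2 x G[OF k] H[OF k] k i s0 dc step] rk by simp
    have "?E $$ (r, c) * d (c div n - 1) $ (c mod n) = \<epsilon> * \<bar>?E $$ (r, c)\<bar>"
      if c: "c < n * (N + 1)" for c
    \<comment> \<open>In block column 0 the truncated index selects \<open>d 0\<close>, whose signs
      come from block column 1; the zero entry makes both sides vanish.\<close>
    proof (cases "c div n = 0")
      case True
      then have "?E $$ (r, c) = 0"
        using r c n q by (simp add: E_mat_def E_block_def)
      then show ?thesis by simp
    next
      case False
      then have "Suc (c div n - 1) * n + c mod n = c" by simp
      then have "d (c div n - 1) $ (c mod n) = \<epsilon> * sgn (?E $$ (r, c))"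
        using n by (simp only: d_def index_vec mod_less_divisor)
      then show ?thesis by (simp add: abs_sgn algebra_simps)
    qed
    with le show "\<epsilon> * (\<Sum>c<n * (N + 1). \<bar>?E $$ (r, c)\<bar>) \<le> ?F $ r"
      by (simp add: sum_distrib_left)
  qed
next
  assume le: "\<forall>r<q * (N + 1). \<epsilon> * (\<Sum>c<n * (N + 1). \<bar>?E $$ (r, c)\<bar>) \<le> ?F $ r"
  show "?T \<subseteq> ?\<psi>"
  proof
    fix s assume s: "s \<in> ?T"
    then obtain d where s0: "s 0 = x" and d: "d \<in> {0..<N} \<rightarrow> disturbance_set n \<epsilon>"
      and step: "\<And>j. j < N \<Longrightarrow> s (Suc j) = A *\<^sub>v s j + B *\<^sub>v controller \<alpha>1 \<alpha>2 (s j) + d j"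
      unfolding trajectories_def by auto
    have dd: "d j \<in> disturbance_set n \<epsilon>" if "j < N" for j using d that by auto
    then have dc: "d j \<in> carrier_vec n" if "j < N" for j
      using that by (auto simp: disturbance_set_def)
    have "G k *\<^sub>v s k \<le> H k" if k: "k \<le> N" for k
      unfolding less_eq_vec_def
    proof (intro conjI allI impI)
      show "dim_vec (G k *\<^sub>v s k) = dim_vec (H k)" using G[OF k] H[OF k] by simp
      fix i assume "i < dim_vec (H k)"
      then have i: "i < q" using H[OF k] by simp
      let ?r = "k * q + i"
      have r: "?r < q * (N + 1)" using block_index_less[OF i k] .
      have "?E $$ (?r, c) * d (c div n - 1) $ (c mod n)
          \<le> \<epsilon> * \<bar>?E $$ (?r, c)\<bar>" if c: "c < n * (N + 1)" for c
      \<comment> \<open>For \<open>N = 0\<close> the vector \<open>d 0\<close> obeys no bound, so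
        block column 0 must be settled by its zero entries alone.\<close>
      proof (cases "c div n = 0")
        case True
        then have "?E $$ (?r, c) = 0"
          using r c n i by (simp add: E_mat_def E_block_def)
        then show ?thesis by simp
      next
        case False
        have "c div n < Suc N" using c n by (simp add: less_mult_imp_div_less mult.commute)
        with False have j: "c div n - 1 < N" by simp
        have "\<bar>d (c div n - 1) $ (c mod n)\<bar> \<le> \<epsilon>"
          using dd[OF j] n by (auto simp: disturbance_set_def linf_norm_le_iff)
        then show ?thesis by (rule mult_le_abs_bound)
      qed
      then have "(\<Sum>c<n * (N + 1). ?E $$ (?r, c) * d (c div n - 1) $ (c mod n))
          \<le> \<epsilon> * (\<Sum>c<n * (N + 1). \<bar>?E $$ (?r, c)\<bar>)"
        unfolding sum_distrib_left by (intro sum_mono) simp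
      also have "\<dots> \<le> ?F $ ?r" using le r by simp
      finally show "(G k *\<^sub>v s k) $ i \<le> H k $ i"
        using trajectory_constraint_iff[of n A B m \<alpha>1 \<alpha>2 x G k q H N i s d,
            OF n A B \<alpha>1 \<alpha>2 x G[OF k] H[OF k] k i s0 dc step] by simp
    qed
    moreover have "s \<in> {0..N} \<rightarrow>\<^sub>E X" using s X by auto
    ultimately show "s \<in> ?\<psi>"
      by (auto simp: product_spec_def polyhedron_in_def PiE_iff)
  qed
qed

section \<open>Nonnegative multipliers and row norms\<close>

text \<open>An identity stacked over its negative combines the two column halves of \<open>P\<close>
  into a difference; the all-ones \<open>B_b\<close> turns them into a sum.\<close>

lemma mult_A_b_index:
  assumes "P \<in> carrier_mat R (2 * n * (N + 1))" "r < R" "c < n * (N + 1)"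
  shows "(P * A_b n N) $$ (r, c) = P $$ (r, c) - P $$ (r, c + n * (N + 1))"
proof -
  define L where "L = n * (N + 1)"
  have L2: "2 * n * (N + 1) = L + L" by (simp add: L_def)
  have P: "P \<in> carrier_mat R (L + L)" and c: "c < L"
    using assms(1,3) unfolding L2 by (simp_all add: L_def)
  have A: "A_b n N \<in> carrier_mat (L + L) L"
    unfolding A_b_def L_def by (intro carrier_append_rows) auto
  have ent: "A_b n N $$ (a, c) = (if a < L then (if a = c then 1 else 0) else (if a - L = c then - 1 else 0))"
    if "a < L + L" for a
    using that c unfolding A_b_def append_rows_def L_def[symmetric] by auto
  have "(P * A_b n N) $$ (r, c) = (\<Sum>a=0..<L + L. P $$ (r, a) * A_b n N $$ (a, c))"
    using P A assms(2) c by (auto simp: scalar_prod_def intro!: sum.cong)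
  also have "\<dots> = (\<Sum>a<L. P $$ (r, a) * A_b n N $$ (a, c) + P $$ (r, a + L) * A_b n N $$ (a + L, c))"
    by (rule sum_lessThan_double)
  also have "\<dots> = (\<Sum>a<L. if a = c then P $$ (r, a) - P $$ (r, a + L) else 0)"
    by (intro sum.cong) (auto simp: ent)
  also have "\<dots> = P $$ (r, c) - P $$ (r, c + L)" using c by simp
  finally show ?thesis by (simp add: L_def)
qed

lemma mult_B_b_index:
  assumes "P \<in> carrier_mat R (2 * n * (N + 1))" "r < R"
  shows "(P *\<^sub>v B_b n N) $ r = (\<Sum>c<n * (N + 1). P $$ (r, c) + P $$ (r, c + n * (N + 1)))"
proof -
  define L where "L = n * (N + 1)"
  have L2: "2 * n * (N + 1) = L + L" by (simp add: L_def)
  have P: "P \<in> carrier_mat R (L + L)" using assms(1) unfolding L2 .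
  have "(P *\<^sub>v B_b n N) $ r = (\<Sum>a=0..<L + L. P $$ (r, a))"
    using P assms(2) unfolding B_b_def ones_vec_def L_def[symmetric]
    by (auto simp: scalar_prod_def intro!: sum.cong)
  also have "\<dots> = (\<Sum>c<L. P $$ (r, c) + P $$ (r, c + L))" by (rule sum_lessThan_double)
  finally show ?thesis by (simp add: L_def)
qed

text \<open>Linear programming duality over a box, made explicit. Any nonnegative \<open>a\<close>
  and \<open>b\<close> satisfy \<open>\<bar>a - b\<bar> \<le> a + b\<close>, with equality when one
  of them is zero. Rows of \<open>P\<close> are independent, so one matrix serves all rows.\<close>

lemma multiplier_exists_iff:
  assumes E: "E \<in> carrier_mat R (n * (N + 1))" and F: "F \<in> carrier_vec R" and \<epsilon>: "(0::real) \<le> \<epsilon>"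
  shows "(\<exists>P \<in> carrier_mat R (2 * n * (N + 1)). P \<ge> 0\<^sub>m R (2 * n * (N + 1)) \<and>
      P * A_b n N = E \<and> \<epsilon> \<cdot>\<^sub>v (P *\<^sub>v B_b n N) \<le> F)
    \<longleftrightarrow> (\<forall>r<R. \<epsilon> * (\<Sum>c<n * (N + 1). \<bar>E $$ (r, c)\<bar>) \<le> F $ r)"
proof -
  define L where "L = n * (N + 1)"
  have L2: "2 * n * (N + 1) = L + L" by (simp add: L_def)
  \<comment> \<open>Writing the width of \<open>P\<close> as \<open>L + L\<close> exposes its two
    halves.\<close>
  note AI = mult_A_b_index[of _ R n N, folded L_def, unfolded L2]
    and BI = mult_B_b_index[of _ R n N, folded L_def, unfolded L2]
  have E: "E \<in> carrier_mat R L" using E by (simp add: L_def)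
  show ?thesis
    unfolding L2 L_def[symmetric]
  proof
    assume "\<exists>P \<in> carrier_mat R (L + L). P \<ge> 0\<^sub>m R (L + L) \<and>
      P * A_b n N = E \<and> \<epsilon> \<cdot>\<^sub>v (P *\<^sub>v B_b n N) \<le> F"
    then obtain P where P: "P \<in> carrier_mat R (L + L)" and P0: "P \<ge> 0\<^sub>m R (L + L)"
      and PE: "P * A_b n N = E" and PF: "\<epsilon> \<cdot>\<^sub>v (P *\<^sub>v B_b n N) \<le> F" by blast
    show "\<forall>r<R. \<epsilon> * (\<Sum>c<L. \<bar>E $$ (r, c)\<bar>) \<le> F $ r"
    proof (intro allI impI)
      fix r assume r: "r < R"
      have pos: "0 \<le> P $$ (r, c)" if "c < L + L" for c
        using P P0 r that by (simp add: less_eq_mat_def)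
      have "\<bar>E $$ (r, c)\<bar> \<le> P $$ (r, c) + P $$ (r, c + L)" if "c < L" for c
        using AI[OF P r that] pos[of c] pos[of "c + L"] that by (simp add: PE)
      then have "(\<Sum>c<L. \<bar>E $$ (r, c)\<bar>) \<le> (P *\<^sub>v B_b n N) $ r"
        unfolding BI[OF P r] by (intro sum_mono) simp
      then have "\<epsilon> * (\<Sum>c<L. \<bar>E $$ (r, c)\<bar>) \<le> \<epsilon> * (P *\<^sub>v B_b n N) $ r"
        using \<epsilon> by (rule mult_left_mono)
      also have "\<dots> = (\<epsilon> \<cdot>\<^sub>v (P *\<^sub>v B_b n N)) $ r" using P r by simp
      also have "\<dots> \<le> F $ r"
        using PF r F by (simp only: less_eq_vec_def carrier_vecD)
      finally show "\<epsilon> * (\<Sum>c<L. \<bar>E $$ (r, c)\<bar>) \<le> F $ r" .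
    qed
  next
    assume le: "\<forall>r<R. \<epsilon> * (\<Sum>c<L. \<bar>E $$ (r, c)\<bar>) \<le> F $ r"
    \<comment> \<open>Positive parts of \<open>E\<close> fill the left half and negative parts the
      right half: their difference is the entry, their sum its absolute value.\<close>
    define P where "P = mat R (L + L)
      (\<lambda>(r, c). if c < L then max 0 (E $$ (r, c)) else max 0 (- E $$ (r, c - L)))"
    have P: "P \<in> carrier_mat R (L + L)" by (simp add: P_def)
    have "P \<ge> 0\<^sub>m R (L + L)" by (auto simp: P_def less_eq_mat_def)
    moreover have "P * A_b n N = E"
    proof (rule eq_matI)
      show "dim_row (P * A_b n N) = dim_row E" "dim_col (P * A_b n N) = dim_col E"
        using P E by (auto simp: A_b_def append_rows_def L_def)
      fix r c assume "r < dim_row E" "c < dim_col E"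
      then have r: "r < R" and c: "c < L" using E by auto
      show "(P * A_b n N) $$ (r, c) = E $$ (r, c)"
        unfolding AI[OF P r c] using r c by (simp add: P_def)
    qed
    moreover have "\<epsilon> \<cdot>\<^sub>v (P *\<^sub>v B_b n N) \<le> F"
      unfolding less_eq_vec_def
    proof (intro conjI allI impI)
      show "dim_vec (\<epsilon> \<cdot>\<^sub>v (P *\<^sub>v B_b n N)) = dim_vec F" using P F by simp
      fix r assume "r < dim_vec F"
      then have r: "r < R" using F by simp
      have "(P *\<^sub>v B_b n N) $ r = (\<Sum>c<L. \<bar>E $$ (r, c)\<bar>)"
        unfolding BI[OF P r] using r by (intro sum.cong) (auto simp: P_def)
      moreover have "(\<epsilon> \<cdot>\<^sub>v (P *\<^sub>v B_b n N)) $ r = \<epsilon> * (P *\<^sub>v B_b n N) $ r" using P r by simp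
      ultimately show "(\<epsilon> \<cdot>\<^sub>v (P *\<^sub>v B_b n N)) $ r \<le> F $ r" using le r by simp
    qed
    ultimately show "\<exists>P \<in> carrier_mat R (L + L). P \<ge> 0\<^sub>m R (L + L) \<and>
      P * A_b n N = E \<and> \<epsilon> \<cdot>\<^sub>v (P *\<^sub>v B_b n N) \<le> F" using P by blast
  qed
qed

section \<open>From equal sets of levels to the resilience\<close>

lemma trajectories_mono:
  assumes "\<epsilon> \<le> \<epsilon>'"
  shows "trajectories n A B N x \<alpha>1 \<alpha>2 \<epsilon> \<subseteq> trajectories n A B N x \<alpha>1 \<alpha>2 \<epsilon>'"
proof -
  have "disturbance_set n \<epsilon> \<subseteq> disturbance_set n \<epsilon>'"
    using assms by (auto simp: disturbance_set_def)
  then show ?thesis unfolding trajectories_def by blast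
qed

text \<open>If every nominal trajectory violates \<open>\<psi>\<close>, then by monotonicity no
  level is robust, and the empty supremum in \<open>ennreal\<close> is 0, the value prescribed in
  that case.\<close>

lemma resilience_eq_Sup:
  "resilience n m A B N \<psi> x = Sup (ennreal ` robust_levels n m A B N \<psi> x)"
proof (cases "\<exists>\<alpha>1 \<in> carrier_mat m n. \<exists>\<alpha>2 \<in> carrier_vec m. trajectories n A B N x \<alpha>1 \<alpha>2 0 \<subseteq> \<psi>")
  case False
  then have "robust_levels n m A B N \<psi> x = {}"
    unfolding robust_levels_def using trajectories_mono by blast
  then show ?thesis using False by (simp add: resilience_def bot_ennreal)
qed (simp add: resilience_def)


theorem theorem1:
  fixes n m q N :: nat
    and A B :: "real mat"
    and G :: "nat \<Rightarrow> real mat" and H :: "nat \<Rightarrow> real vec"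
    and X :: "real vec set" and x :: "real vec"
  assumes "n > 0" and "m > 0" and "q > 0" and "N > 0"
    and "A \<in> carrier_mat n n" and "B \<in> carrier_mat n m"
    and "\<And>i. i \<le> N \<Longrightarrow> G i \<in> carrier_mat q n"
    and "\<And>i. i \<le> N \<Longrightarrow> H i \<in> carrier_vec q"
    and "X \<subseteq> carrier_vec n"
    and nominal_map: "\<And>z u. z \<in> X \<Longrightarrow> u \<in> carrier_vec m \<Longrightarrow> A *\<^sub>v z + B *\<^sub>v u \<in> X"
    and trajectories_in_X: "\<And>z \<alpha>1 \<alpha>2 \<epsilon>. z \<in> X \<Longrightarrow> \<alpha>1 \<in> carrier_mat m n \<Longrightarrow> \<alpha>2 \<in> carrier_vec m \<Longrightarrow>
          \<epsilon> \<ge> 0 \<Longrightarrow> trajectories n A B N z \<alpha>1 \<alpha>2 \<epsilon> \<subseteq> {0..N} \<rightarrow>\<^sub>E X"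
    and "x \<in> X"
  shows "resilience n m A B N (product_spec X N G H) x
           = Sup (ennreal ` feasible_levels n m q A B N G H x)
       \<and> (\<forall>v. is_maximum (robust_levels n m A B N (product_spec X N G H) x) v
              \<longleftrightarrow> is_maximum (feasible_levels n m q A B N G H x) v)"
proof -
  have x: "x \<in> carrier_vec n" using assms by auto
  \<comment> \<open>Equality of the sets themselves yields both claims, whether or not the supremum
    is attained or finite.\<close>
  have "robust_levels n m A B N (product_spec X N G H) x = feasible_levels n m q A B N G H x"
    unfolding robust_levels_def feasible_levels_def
  proof (intro Collect_cong conj_cong bex_cong refl)
    fix \<epsilon> :: real and \<alpha>1 :: "real mat" and \<alpha>2 :: "real vec"
    assume \<epsilon>: "0 \<le> \<epsilon>" and \<alpha>: "\<alpha>1 \<in> carrier_mat m n" "\<alpha>2 \<in> carrier_vec m"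
    have E: "E_mat n q A B N G \<alpha>1 \<in> carrier_mat (q * (N + 1)) (n * (N + 1))"
      by (simp add: E_mat_def)
    have F: "F_vec n q A B N G H x \<alpha>1 \<alpha>2 \<in> carrier_vec (q * (N + 1))"
      by (simp add: F_vec_def)
    show "(trajectories n A B N x \<alpha>1 \<alpha>2 \<epsilon> \<subseteq> product_spec X N G H) =
      (\<exists>P \<in> carrier_mat (q * (N + 1)) (2 * n * (N + 1)).
         P \<ge> 0\<^sub>m (q * (N + 1)) (2 * n * (N + 1)) \<and>
         P * A_b n N = E_mat n q A B N G \<alpha>1 \<and>
         \<epsilon> \<cdot>\<^sub>v (P *\<^sub>v B_b n N) \<le> F_vec n q A B N G H x \<alpha>1 \<alpha>2)"
      unfolding multiplier_exists_iff[OF E F \<epsilon>]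
      using trajectories_in_X[OF \<open>x \<in> X\<close> \<alpha> \<epsilon>]
      by (intro trajectories_subset_iff[where m = m] assms x \<epsilon> \<alpha>)
  qed
  then show ?thesis by (simp add: resilience_eq_Sup)
qed

end
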